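(* Let $K_{2,n}$ be the complete bipartite graph with parts of sizes $2$ and $n$. Then: (a) $\chi_g^\infty(K_{2,n}) = 4$ if $n \in \{2,3\}$; (b) $\chi_g^\infty(K_{2,n}) \geq n/2+3$ if $n>3$ is even; (c) $\chi_g^\infty(K_{2,n}) \geq \lfloor \frac{n}{2} \rfloor + 3$ if $n>3$ is odd.
   Context: The eternal vertex coloring game (A-game) on a finite undirected graph $G$ with color set $\{1,\ldots,k\}$: all vertices are initially uncolored. Alice and Bob strictly alternate turns, Alice moving first overall. On a turn the player chooses one vertex. If it is uncolored, the player must give it a color not currently used on any of its neighbors; if it currently has color $c$, the player must change its color to a color different from $c$ that is not currently used on any of its neighbors. The player whose turn it is picks the vertex and the new color. Play proceeds in rounds: every vertex must be chosen $t$ times before any vertex is chosen $t+1$ times, for every integer $t\ge 1$ (so each vertex is chosen exactly once per round; turns keep alternating across rounds, so if $|V(G)|$ is odd Bob moves first in even-numbered rounds). If some player chooses a vertex $v$ (still available in the current round) that cannot be legally colored, i.e. every color in the color set other than the current color of $v$ (if any) appears on a neighbor of $v$, then Bob wins. In particular Bob may deliberately choose such a vertex. Alice wins if this never happens (the game goes on forever). The eternal game chromatic number $\chi_g^\infty(G)$ is the minimum $k$ such that Alice has a winning strategy on $G$ with $k$ colors. *)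

theory Defs
  imports Graph_Theory.Kuratowski
begin

text \<open>
  Undirected graphs are the symmetric, loop-free, finite digraphs of the locale \<^locale>\<open>graph\<close>.

  A move is a chosen vertex together with its new color. A history lists the moves made so far,
  most recent move first, so \<^term>\<open>map_of h v\<close> is the current color of \<open>v\<close>
  (\<^term>\<open>None\<close> if \<open>v\<close> is still uncolored). Alice moves after an even number of moves.
\<close>

type_synonym 'a move = "'a \<times> nat"
type_synonym 'a history = "'a move list"

definition times_chosen :: "'a history \<Rightarrow> 'a \<Rightarrow> nat" where
  "times_chosen h v = count_list (map fst h) v"

text \<open>Rounds: no vertex is chosen for the $(t+1)$-st time before all have been chosen $t$ times.\<close>

definition available :: "('a, 'b) pre_digraph \<Rightarrow> 'a history \<Rightarrow> 'a set" where
  "available G h = {v \<in> verts G. \<forall>u \<in> verts G. times_chosen h v \<le> times_chosen h u}"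

definition legal_colors :: "('a, 'b) pre_digraph \<Rightarrow> nat \<Rightarrow> 'a history \<Rightarrow> 'a \<Rightarrow> nat set" where
  "legal_colors G k h v =
     {c \<in> {1..k}. map_of h v \<noteq> Some c \<and> (\<forall>u. v \<rightarrow>\<^bsub>G\<^esub> u \<longrightarrow> map_of h u \<noteq> Some c)}"

definition legal_move :: "('a, 'b) pre_digraph \<Rightarrow> nat \<Rightarrow> 'a history \<Rightarrow> 'a move \<Rightarrow> bool" where
  "legal_move G k h m \<longleftrightarrow> fst m \<in> available G h \<and> snd m \<in> legal_colors G k h (fst m)"

definition alice_turn :: "'a history \<Rightarrow> bool" where
  "alice_turn h \<longleftrightarrow> even (length h)"

text \<open>The histories that can arise when Alice follows the strategy \<open>\<sigma>\<close>, while Bob plays arbitrarily.\<close>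

inductive consistent ::
  "('a, 'b) pre_digraph \<Rightarrow> nat \<Rightarrow> ('a history \<Rightarrow> 'a move) \<Rightarrow> 'a history \<Rightarrow> bool"
  for G k \<sigma> where
  start: "consistent G k \<sigma> []"
| alice: "consistent G k \<sigma> h \<Longrightarrow> alice_turn h \<Longrightarrow> legal_move G k h (\<sigma> h) \<Longrightarrow>
    consistent G k \<sigma> (\<sigma> h # h)"
| bob: "consistent G k \<sigma> h \<Longrightarrow> \<not> alice_turn h \<Longrightarrow> legal_move G k h m \<Longrightarrow>
    consistent G k \<sigma> (m # h)"

text \<open>
  Bob wins as soon as a player chooses an available vertex without a legal color. Hence \<open>\<sigma>\<close> is
  winning iff it always prescribes a legal move to Alice, and at Bob's turns there is no available
  vertex without a legal color, as Bob could otherwise choose it.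
\<close>

definition winning_strategy ::
  "('a, 'b) pre_digraph \<Rightarrow> nat \<Rightarrow> ('a history \<Rightarrow> 'a move) \<Rightarrow> bool" where
  "winning_strategy G k \<sigma> \<longleftrightarrow>
     (\<forall>h. consistent G k \<sigma> h \<longrightarrow>
        (if alice_turn h then legal_move G k h (\<sigma> h)
         else (\<forall>v \<in> available G h. legal_colors G k h v \<noteq> {})))"

text \<open>
  For a nonempty finite graph the minimum exists: with at least two colors more than the maximum
  degree, every vertex always has a legal color.
\<close>

definition eternal_game_chromatic_number :: "('a, 'b) pre_digraph \<Rightarrow> nat" (\<open>\<chi>\<^sub>g\<^sup>\<infinity>\<close>) where
  "\<chi>\<^sub>g\<^sup>\<infinity> G = (LEAST k. \<exists>\<sigma>. winning_strategy G k \<sigma>)"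

end

theory Submission
  imports Defs
begin

text \<open>
  Let \<open>{a, b}\<close> be the part of size two and \<open>V\<close> the part of size \<open>n\<close>.

  Lower bounds: with at most \<open>\<lfloor>n / 2\<rfloor> + 2\<close> colors Bob wins by the second round. When Alice colors one
  of \<open>a, b\<close>, he gives the other one the same color \<open>c\<close>; otherwise he puts a new color on \<open>V\<close>. Since
  Alice's first color on \<open>V\<close> is new as well, at the end of the first round \<open>V\<close> carries every color
  except \<open>c\<close>, so that \<open>a\<close> and \<open>b\<close> have no legal color. If \<open>n\<close> is odd, it is Bob's turn. If \<open>n\<close> is even,
  Alice must remove a color from \<open>V\<close>, and Bob restores it on a vertex whose color occurs elsewhere in
  \<open>V\<close>; Alice eventually runs out of vertices of \<open>V\<close>.

  Upper bounds: \<open>n + 2\<close> colors always suffice. If \<open>n = 3\<close>, then with four colors only \<open>a\<close> and \<open>b\<close> can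
  be without a legal color, and only if \<open>V\<close> has three colors. In the rounds that she begins, Alice
  makes two chosen vertices of \<open>V\<close> share a color by her second move, which keeps \<open>V\<close> from having three
  colors until the end of the round. In the rounds that Bob begins, she removes the third color from \<open>V\<close>
  whenever it appears, and chooses \<open>a\<close> or \<open>b\<close> otherwise.
\<close>

section \<open>Invariants of the game\<close>

text \<open>In both rules the invariant is only required at Alice's turns.\<close>

lemma alice_winsI:
  assumes "I []"
    and step: "\<And>h. I h \<Longrightarrow> \<exists>m. legal_move G k h m
      \<and> (\<forall>v \<in> available G (m # h). legal_colors G k (m # h) v \<noteq> {})
      \<and> (\<forall>m'. legal_move G k (m # h) m' \<longrightarrow> I (m' # m # h))"
  shows "\<exists>\<sigma>. winning_strategy G k \<sigma>"
proof -
  define \<sigma> where "\<sigma> h = (SOME m. legal_move G k h m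
      \<and> (\<forall>v \<in> available G (m # h). legal_colors G k (m # h) v \<noteq> {})
      \<and> (\<forall>m'. legal_move G k (m # h) m' \<longrightarrow> I (m' # m # h)))" for h
  have \<sigma>: "legal_move G k h (\<sigma> h)"
    "\<And>v. v \<in> available G (\<sigma> h # h) \<Longrightarrow> legal_colors G k (\<sigma> h # h) v \<noteq> {}"
    "\<And>m'. legal_move G k (\<sigma> h # h) m' \<Longrightarrow> I (m' # \<sigma> h # h)" if "I h" for h
    using someI_ex[OF step[OF that]] unfolding \<sigma>_def by blast+
  \<comment> \<open>At Bob's turns \<open>I\<close> itself is not assumed; recorded instead is that
    the play arose from an \<open>I\<close>-state by Alice's chosen move.\<close>
  have inv: "if alice_turn h then I h else \<exists>h'. h = \<sigma> h' # h' \<and> I h'"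
    if "consistent G k \<sigma> h" for h
    using that
  proof induction
    case start
    then show ?case using assms(1) by (simp add: alice_turn_def)
  next
    case (alice h)
    then show ?case by (auto simp: alice_turn_def)
  next
    case (bob h m)
    then show ?case using \<sigma>(3) by (cases m) (auto simp: alice_turn_def)
  qed
  have "winning_strategy G k \<sigma>"
    unfolding winning_strategy_def using inv \<sigma>(1,2) by (metis (full_types))
  then show ?thesis by blast
qed

lemma bob_winsI:
  assumes "J []"
    and step: "\<And>h m. J h \<Longrightarrow> legal_move G k h m \<Longrightarrow>
      (\<exists>v \<in> available G (m # h). legal_colors G k (m # h) v = {})
      \<or> (\<exists>m'. legal_move G k (m # h) m' \<and> J (m' # m # h))"
    and bound: "\<And>h. J h \<Longrightarrow> length h \<le> N"
  shows "\<not> winning_strategy G k \<sigma>"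
proof
  assume win: "winning_strategy G k \<sigma>"
  \<comment> \<open>Since \<open>\<sigma>\<close> wins, the first alternative of \<open>step\<close>
    never occurs, so Bob always has a reply into \<open>J\<close> and the play outgrows
    \<open>N\<close>.\<close>
  have "\<exists>h. consistent G k \<sigma> h \<and> J h \<and> length h = 2 * i" for i
  proof (induction i)
    case 0
    then show ?case using assms(1) consistent.start by auto
  next
    case (Suc i)
    then obtain h where h: "consistent G k \<sigma> h" "J h" "length h = 2 * i" by blast
    then have A: "alice_turn h" by (simp add: alice_turn_def)
    then have L: "legal_move G k h (\<sigma> h)"
      using win h(1) unfolding winning_strategy_def by metis
    have C: "consistent G k \<sigma> (\<sigma> h # h)" using consistent.alice h(1) A L .
    have B: "\<not> alice_turn (\<sigma> h # h)" using A by (simp add: alice_turn_def)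
    then obtain m where "legal_move G k (\<sigma> h # h) m" "J (m # \<sigma> h # h)"
      using step[OF h(2) L] win C unfolding winning_strategy_def by metis
    then show ?case using consistent.bob[OF C B] h(3) by fastforce
  qed
  then obtain h where "J h" "length h = 2 * Suc N" by blast
  then show False using bound by fastforce
qed

lemma ex_color_notin:
  assumes "finite B" "card B < k"
  shows "\<exists>c \<in> {1..k}. Some c \<notin> B"
proof -
  have "card B < card (Some ` {1..k})" using assms by (simp add: card_image)
  then have "\<not> Some ` {1..k} \<subseteq> B" using assms card_mono leD by blast
  then show ?thesis by blast
qed

lemma available_nonempty:
  assumes "finite (verts G)" "verts G \<noteq> {}"
  shows "available G h \<noteq> {}"
  using ex_min_if_finite[of "times_chosen h ` verts G"] assms
  by (auto simp: available_def not_less)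

text \<open>Its own color and those of its neighbors rule out at most degree + 1 colors, so no
  vertex can ever be stuck and the trivial invariant works.\<close>

lemma alice_wins_if_degree_small:
  assumes "finite (verts G)" "verts G \<noteq> {}"
    and deg: "\<And>v. v \<in> verts G \<Longrightarrow> finite {u. v \<rightarrow>\<^bsub>G\<^esub> u} \<and> card {u. v \<rightarrow>\<^bsub>G\<^esub> u} + 2 \<le> k"
  shows "\<exists>\<sigma>. winning_strategy G k \<sigma>"
proof (rule alice_winsI[where I = "\<lambda>_. True"])
  have L: "legal_colors G k h v \<noteq> {}" if "v \<in> verts G" for h v
  proof -
    define B where "B = map_of h ` insert v {u. v \<rightarrow>\<^bsub>G\<^esub> u}"
    have fin: "finite {u. v \<rightarrow>\<^bsub>G\<^esub> u}" using deg[OF that] by blast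
    then have "card B \<le> Suc (card {u. v \<rightarrow>\<^bsub>G\<^esub> u})"
      unfolding B_def using card_image_le[of "insert v {u. v \<rightarrow>\<^bsub>G\<^esub> u}" "map_of h"]
      by (simp add: card_insert_if split: if_splits)
    then have "card B < k" using deg[OF that] by simp
    moreover have "finite B" using fin by (simp add: B_def)
    ultimately show ?thesis
      using ex_color_notin[of B k] unfolding legal_colors_def B_def by force
  qed
  fix h :: "'a history"
  obtain v where "v \<in> available G h" using available_nonempty[OF assms(1,2)] by blast
  moreover from this obtain c where "c \<in> legal_colors G k h v"
    using L by (fastforce simp: available_def)
  ultimately show "\<exists>m. legal_move G k h m
      \<and> (\<forall>v \<in> available G (m # h). legal_colors G k (m # h) v \<noteq> {})
      \<and> (\<forall>m'. legal_move G k (m # h) m' \<longrightarrow> True)"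
    using L by (intro exI[of _ "(v, c)"]) (auto simp: legal_move_def available_def)
qed simp

section \<open>Complete bipartite graphs with a part of size two\<close>

locale K2n =
  fixes G :: "('a, 'b) pre_digraph" and a b :: 'a and V :: "'a set" and n :: nat
  assumes verts: "verts G = {a, b} \<union> V"
    and ab: "a \<noteq> b" "a \<notin> V" "b \<notin> V"
    and V: "finite V" "card V = n"
    and arcs: "arcs_ends G = {a, b} \<times> V \<union> V \<times> {a, b}"
begin

lemma card_verts: "card (verts G) = n + 2"
  using verts ab V by simp

lemma finite_verts: "finite (verts G)"
  using verts V by simp

lemma legal_colors_V:
  "v \<in> V \<Longrightarrow> legal_colors G k h v =
    {c \<in> {1..k}. map_of h v \<noteq> Some c \<and> map_of h a \<noteq> Some c \<and> map_of h b \<noteq> Some c}"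
  using ab by (auto simp: legal_colors_def arcs)

lemma legal_colors_U:
  "u \<in> {a, b} \<Longrightarrow> legal_colors G k h u =
    {c \<in> {1..k}. map_of h u \<noteq> Some c \<and> Some c \<notin> map_of h ` V}"
  using ab by (auto simp: legal_colors_def arcs) (metis imageI)+

text \<open>\<open>S\<close> is the set of vertices already chosen in the current round, after \<open>t\<close> complete rounds.\<close>

definition in_round :: "nat \<Rightarrow> 'a history \<Rightarrow> nat \<Rightarrow> 'a set \<Rightarrow> bool" where
  "in_round k h t S \<longleftrightarrow> S \<subseteq> verts G \<and> length h = t * (n + 2) + card S
    \<and> snd ` set h \<subseteq> {1..k}
    \<and> (\<forall>v \<in> verts G. times_chosen h v = t + of_bool (v \<in> S))
    \<and> (\<forall>v \<in> V. map_of h v = None \<or> map_of h v \<noteq> map_of h a \<and> map_of h v \<noteq> map_of h b)"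

lemma in_round_Nil: "in_round k [] 0 {}"
  by (simp add: in_round_def times_chosen_def)

lemma in_round_full: "in_round k h t (verts G) \<Longrightarrow> in_round k h (Suc t) {}"
  using card_verts by (auto simp: in_round_def)

lemma in_round_available:
  assumes "in_round k h t S" "S \<noteq> verts G"
  shows "available G h = verts G - S"
proof -
  obtain w where "w \<in> verts G" "w \<notin> S" using assms by (auto simp: in_round_def)
  then show ?thesis using assms
    by (fastforce simp: in_round_def available_def split: if_splits)
qed

lemma in_round_move:
  assumes R: "in_round k h t S" "S \<noteq> verts G" and L: "legal_move G k h (v, c)"
  shows "v \<in> verts G - S" "in_round k ((v, c) # h) t (insert v S)"
proof -
  show v: "v \<in> verts G - S"
    using L in_round_available[OF R] by (simp add: legal_move_def)
  have c: "c \<in> legal_colors G k h v" using L by (simp add: legal_move_def)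
  have "finite S" using R finite_verts by (auto simp: in_round_def dest: finite_subset)
  moreover have "w \<in> V \<Longrightarrow> map_of ((v, c) # h) w = None \<or>
     map_of ((v, c) # h) w \<noteq> map_of ((v, c) # h) a \<and> map_of ((v, c) # h) w \<noteq> map_of ((v, c) # h) b"
    for w
  proof (cases "v \<in> V")
    case True
    then show "w \<in> V \<Longrightarrow> ?thesis" using c R ab by (auto simp: legal_colors_V in_round_def)
  next
    case False
    then have "v \<in> {a, b}" using v verts by blast
    then have "w \<in> V \<Longrightarrow> map_of h w \<noteq> Some c" using c by (force simp: legal_colors_U)
    then show "w \<in> V \<Longrightarrow> ?thesis" using \<open>v \<in> {a, b}\<close> R ab by (auto simp: in_round_def)
  qed
  moreover have "c \<in> {1..k}" using c by (simp add: legal_colors_def)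
  ultimately show "in_round k ((v, c) # h) t (insert v S)"
    using R v unfolding in_round_def by (auto simp: times_chosen_def)
qed

lemma in_round_None:
  assumes "in_round k h t S" "v \<in> verts G"
  shows "map_of h v = None \<longleftrightarrow> t = 0 \<and> v \<notin> S"
proof -
  have "map_of h v = None \<longleftrightarrow> times_chosen h v = 0"
    by (simp add: times_chosen_def count_list_0_iff map_of_eq_None_iff)
  then show ?thesis using assms by (auto simp: in_round_def)
qed

lemma in_round_Some:
  "in_round k h t S \<Longrightarrow> map_of h v = Some c \<Longrightarrow> c \<in> {1..k}"
  by (force simp: in_round_def dest: map_of_SomeD)


lemma in_round_legalI:
  "in_round k h t S \<Longrightarrow> v \<in> verts G - S \<Longrightarrow> c \<in> legal_colors G k h v \<Longrightarrow> legal_move G k h (v, c)"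
  using in_round_available[of k h t S] by (auto simp: legal_move_def)

section \<open>Bob's strategy\<close>

text \<open>Apart from its own color, \<open>a\<close> or \<open>b\<close> may receive exactly
  these. Bob wants the set to shrink to \<open>{c}\<close>, with \<open>c\<close> on both of
  them.\<close>

definition missing :: "nat \<Rightarrow> 'a history \<Rightarrow> nat set" where
  "missing k h = {c \<in> {1..k}. Some c \<notin> map_of h ` V}"

lemma finite_missing: "finite (missing k h)"
  by (simp add: missing_def)

lemma missingD: "c \<in> missing k h \<Longrightarrow> v \<in> V \<Longrightarrow> map_of h v \<noteq> Some c"
  unfolding missing_def by (metis (mono_tags, lifting) imageI mem_Collect_eq)

lemma missing_eq_singleton: "card (missing k h) \<le> 1 \<Longrightarrow> c \<in> missing k h \<Longrightarrow> missing k h = {c}"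
  using card_le_Suc0_iff_eq[OF finite_missing, of k h] by auto

lemma legal_colors_missing:
  "u \<in> {a, b} \<Longrightarrow> legal_colors G k h u = missing k h - {c. map_of h u = Some c}"
  by (auto simp: legal_colors_U missing_def)

lemma missing_U: "v \<notin> V \<Longrightarrow> missing k ((v, c) # h) = missing k h"
  by (force simp: missing_def)

lemma missing_uncolored:
  "v \<in> V \<Longrightarrow> map_of h v = None \<Longrightarrow> missing k ((v, c) # h) = missing k h - {c}"
  by (force simp: missing_def)

definition stuck :: "nat \<Rightarrow> 'a history \<Rightarrow> bool" where
  "stuck k h \<longleftrightarrow> (\<exists>v \<in> available G h. legal_colors G k h v = {})"

lemma stuckI:
  assumes "in_round k h t S" "u \<in> {a, b} - S" "missing k h \<subseteq> {c. map_of h u = Some c}"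
  shows "stuck k h"
proof -
  have "u \<in> available G h" using assms in_round_available verts by blast
  moreover have "legal_colors G k h u = {}" using assms by (subst legal_colors_missing) auto
  ultimately show ?thesis by (auto simp: stuck_def)
qed

text \<open>
  The last case of the first round is needed for odd \<open>n\<close> only: Alice has avoided \<open>a\<close> and \<open>b\<close>, so Bob
  had to choose one of them, and the other one is left for Alice. In the second round, a color on a
  chosen vertex of \<open>V\<close> can no longer be removed; \<open>bob_second\<close> counts these colors.
\<close>

definition bob_first :: "nat \<Rightarrow> 'a history \<Rightarrow> 'a set \<Rightarrow> nat \<Rightarrow> bool" where
  "bob_first k h S i \<longleftrightarrow> in_round k h 0 S \<and> card (S \<inter> V) = 2 * i
    \<and> (i = 0 \<or> card (missing k h) \<le> max 1 (k - i - 1))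
    \<and> (S \<subseteq> V \<or> ({a, b} \<subseteq> S \<and> (\<exists>c \<in> missing k h. map_of h a = Some c \<and> map_of h b = Some c)))"

definition bob_last :: "nat \<Rightarrow> 'a history \<Rightarrow> bool" where
  "bob_last k h \<longleftrightarrow> (\<exists>u \<in> {a, b}. \<exists>c. in_round k h 0 (insert u V) \<and> missing k h = {c} \<and> map_of h u = Some c)"

definition bob_second :: "nat \<Rightarrow> 'a history \<Rightarrow> 'a set \<Rightarrow> nat \<Rightarrow> bool" where
  "bob_second k h S j \<longleftrightarrow> in_round k h 1 S \<and> S \<subseteq> V \<and> card S = 2 * j
    \<and> (\<exists>c. missing k h = {c} \<and> map_of h a = Some c \<and> map_of h b = Some c)
    \<and> (j = 0 \<or> j + 1 \<le> card (map_of h ` S))"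

definition bob_inv :: "nat \<Rightarrow> 'a history \<Rightarrow> bool" where
  "bob_inv k h \<longleftrightarrow> (\<exists>S i. S \<noteq> verts G \<and> bob_first k h S i) \<or> bob_last k h \<or> (\<exists>S j. bob_second k h S j)"

lemma bob_inv_Nil: "bob_inv k []"
proof -
  have "bob_first k [] {} 0" by (simp add: bob_first_def in_round_Nil)
  moreover have "{} \<noteq> verts G" using verts by auto
  ultimately show ?thesis unfolding bob_inv_def by blast
qed

lemma bob_inv_length: "bob_inv k h \<Longrightarrow> length h \<le> 2 * (n + 2)"
proof -
  have *: "length h \<le> 2 * (n + 2)" if "in_round k h t S" "t \<le> 1" for t S
  proof -
    have "card S \<le> n + 2"
      using that card_verts card_mono[OF finite_verts] by (metis in_round_def)
    moreover have "t * (n + 2) \<le> n + 2" using that(2) by (cases t) auto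
    ultimately show ?thesis using that(1) by (simp add: in_round_def)
  qed
  show "bob_inv k h \<Longrightarrow> ?thesis"
    unfolding bob_inv_def bob_first_def bob_last_def bob_second_def
    using *[of 0] *[of 1] by (elim disjE exE conjE bexE) simp_all
qed

section \<open>Bob's replies in the first round\<close>

context
  fixes k :: nat
  assumes n: "2 \<le> n" and k: "k \<le> n div 2 + 2"
begin

text \<open>If the round is complete, then \<open>n = 2 * i\<close>, and
  \<open>k - i - 1 \<le> 1\<close> leaves \<open>c\<close> as the only missing color: the second
  round starts with \<open>j = 0\<close>.\<close>

lemma bob_first_imp_inv:
  assumes "bob_first k h S i"
  shows "bob_inv k h"
proof (cases "S = verts G")
  case True
  then have "S \<inter> V = V" using verts by blast
  then have *: "in_round k h 1 {}" "card (S \<inter> V) = n"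
    using assms True in_round_full V(2) by (auto simp: bob_first_def)
  then have i: "n = 2 * i" using assms by (simp add: bob_first_def)
  then have "i \<noteq> 0" using n by simp
  then have "card (missing k h) \<le> max 1 (k - i - 1)" using assms by (simp add: bob_first_def)
  then have "card (missing k h) \<le> 1" using k i by linarith
  moreover obtain c where c: "c \<in> missing k h" "map_of h a = Some c" "map_of h b = Some c"
    using assms True verts ab by (auto simp: bob_first_def)
  ultimately have "missing k h = {c}" by (intro missing_eq_singleton)
  then have "bob_second k h {} 0" using * c by (auto simp: bob_second_def)
  then show ?thesis by (auto simp: bob_inv_def)
next
  case False
  then show ?thesis using assms by (auto simp: bob_inv_def)
qed

text \<open>Bob copies \<open>c\<close> to the twin of Alice's vertex: both have neighborhood
  \<open>V\<close>, where \<open>c\<close> is absent.\<close>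

lemma bob_first_step_U:
  assumes F: "bob_first k h S i" "S \<noteq> verts G" and L: "legal_move G k h (x, c)"
    and xy: "{x, y} = {a, b}"
  shows "\<exists>m'. legal_move G k ((x, c) # h) m' \<and> bob_inv k (m' # (x, c) # h)"
proof -
  let ?h = "(x, c) # h"
  have R: "in_round k h 0 S" using F by (simp add: bob_first_def)
  have x: "x \<notin> S" and R': "in_round k ?h 0 (insert x S)"
    using in_round_move[OF R F(2) L] by auto
  have xyU: "x \<in> {a, b}" "y \<in> {a, b}" "x \<notin> V" "y \<notin> V" "x \<noteq> y" using xy ab by auto
  have SV: "S \<subseteq> V" using F(1) x xyU by (auto simp: bob_first_def)
  have c: "c \<in> missing k h"
    using L xyU by (simp add: legal_move_def legal_colors_missing)
  have y: "y \<in> verts G - insert x S" using xyU SV verts by auto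
  then have yN: "map_of h y = None" using in_round_None[OF R] by simp
  have "c \<in> legal_colors G k ?h y"
    using c xyU yN by (simp add: legal_colors_missing missing_U)
  then have L': "legal_move G k ?h (y, c)"
    using in_round_legalI[OF R' y] by blast
  moreover have "bob_first k ((y, c) # ?h) (insert y (insert x S)) i"
  proof -
    have "insert x S \<noteq> verts G" using y by blast
    then have "in_round k ((y, c) # ?h) 0 (insert y (insert x S))"
      using in_round_move[OF R' _ L'] by blast
    moreover have "insert y (insert x S) \<inter> V = S \<inter> V" using xyU by auto
    ultimately show ?thesis
      using F(1) xy xyU c unfolding bob_first_def by (auto simp: missing_U doubleton_eq_iff)
  qed
  ultimately show ?thesis using bob_first_imp_inv by blast
qed

text \<open>While \<open>V\<close> has an unchosen vertex, Bob answers there, if possible with a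
  missing color other than that of \<open>a\<close> and \<open>b\<close>. If Alice has taken the
  last one, \<open>n\<close> is odd, and Bob wins at once or plays \<open>a\<close>.\<close>

lemma bob_first_step_V:
  assumes F: "bob_first k h S i" "S \<noteq> verts G" and L: "legal_move G k h (v, d)"
    and v: "v \<in> V"
  shows "stuck k ((v, d) # h) \<or>
    (\<exists>m'. legal_move G k ((v, d) # h) m' \<and> bob_inv k (m' # (v, d) # h))"
proof -
  let ?h = "(v, d) # h" and ?S = "insert v S"
  have R: "in_round k h 0 S" and card: "card (S \<inter> V) = 2 * i" using F by (auto simp: bob_first_def)
  have vS: "v \<notin> S" and R': "in_round k ?h 0 ?S"
    using in_round_move[OF R F(2) L] by auto
  have vN: "map_of h v = None" using in_round_None[OF R] v vS verts by auto
  have dL: "d \<in> {1..k}" "map_of h a \<noteq> Some d" "map_of h b \<noteq> Some d"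
    using L v by (auto simp: legal_move_def legal_colors_V)
  have M: "missing k ?h = missing k h - {d}" using missing_uncolored[OF v vN] .
  \<comment> \<open>Alice's first color on \<open>V\<close> leaves \<open>k - 1\<close> missing
    colors, and each of Bob's replies there removes one more until at most one remains.\<close>
  have cardM: "card (missing k ?h) \<le> max 1 (k - i - 1)"
  proof (cases "i = 0")
    case True
    then have "S \<inter> V = {}" using card V by auto
    then have "missing k h = {1..k}"
      using in_round_None[OF R] verts by (force simp: missing_def)
    then show ?thesis using M dL(1) True by simp
  next
    case False
    then have "card (missing k h) \<le> max 1 (k - i - 1)" using F by (simp add: bob_first_def)
    then show ?thesis unfolding M using card_Diff1_le[of "missing k h" d] by linarith
  qed
  have card': "card (?S \<inter> V) = 2 * i + 1" using card vS v V(1) by simp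
  consider (unc) "S \<subseteq> V" "map_of h a = None" "map_of h b = None"
    | (col) c where "{a, b} \<subseteq> S" "c \<in> missing k ?h" "map_of h a = Some c" "map_of h b = Some c"
  proof (cases "S \<subseteq> V")
    case True
    then have "a \<notin> S" "b \<notin> S" "a \<in> verts G" "b \<in> verts G" using ab verts by auto
    then show ?thesis using unc True in_round_None[OF R] by simp
  next
    case False
    then obtain c where "{a, b} \<subseteq> S" "c \<in> missing k h" "map_of h a = Some c" "map_of h b = Some c"
      using F by (auto simp: bob_first_def)
    then show ?thesis using col dL M by fastforce
  qed
  note UV = this
  have va: "map_of ?h a = map_of h a" "map_of ?h b = map_of h b" using v ab by auto
  show ?thesis
  proof (cases "V \<subseteq> ?S")
    case False
    then obtain w where w: "w \<in> V" "w \<notin> ?S" "w \<in> verts G - ?S" using verts by blast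
    then have wN: "map_of ?h w = None" using in_round_None[OF R', of w] by simp
    have ne: "?S \<noteq> verts G" using w by blast
    \<comment> \<open>Bob's reply \<open>e\<close> at \<open>w\<close>: a missing \<open>e\<close>
      lowers the count by one; otherwise the bound 1 is already reached and any legal
      \<open>e\<close> will do.\<close>
    have go: ?thesis if e: "e \<in> {1..k}" "map_of h a \<noteq> Some e" "map_of h b \<noteq> Some e"
      and E: "e \<in> missing k ?h \<or> card (missing k ?h) \<le> 1" for e
    proof -
      have "e \<in> legal_colors G k ?h w" using e w wN va by (simp add: legal_colors_V)
      then have L': "legal_move G k ?h (w, e)" using in_round_legalI[OF R' w(3)] by blast
      have R'': "in_round k ((w, e) # ?h) 0 (insert w ?S)"
        using in_round_move[OF R' ne L'] by blast
      have M': "missing k ((w, e) # ?h) = missing k ?h - {e}"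
        by (rule missing_uncolored[OF w(1) wN])
      have "card (missing k ?h - {e}) \<le> max 1 (k - (i + 1) - 1)"
      proof (cases "e \<in> missing k ?h")
        case True
        then have "card (missing k ?h - {e}) = card (missing k ?h) - 1"
          by (simp add: card_Diff_singleton)
        then show ?thesis using cardM by linarith
      next
        case False
        then show ?thesis using E by simp
      qed
      moreover have "card (insert w ?S \<inter> V) = 2 * (i + 1)" using card' w V(1) by simp
      moreover have "map_of ((w, e) # ?h) a = map_of h a" "map_of ((w, e) # ?h) b = map_of h b"
        using w v ab by auto
      ultimately have "bob_first k ((w, e) # ?h) (insert w ?S) (i + 1)"
        using R'' M' UV v w e unfolding bob_first_def by (cases rule: UV) auto
      then show ?thesis using L' bob_first_imp_inv by blast
    qed
    show ?thesis
    proof (cases rule: UV)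
      case unc
      show ?thesis
      proof (cases "missing k ?h = {}")
        case True
        then show ?thesis using stuckI[OF R', of a] unc(1) ab v by blast
      next
        case False
        then obtain e where "e \<in> missing k ?h" by blast
        then show ?thesis using go[of e] unc by (auto simp: missing_def)
      qed
    next
      case (col c)
      show ?thesis
      proof (cases "missing k ?h = {c}")
        case True
        \<comment> \<open>Only \<open>c\<close> is missing and must remain so; Bob repeats Alice's
          color \<open>d\<close>, which neither \<open>a\<close> nor \<open>b\<close> has.\<close>
        then show ?thesis using go[OF dL] by simp
      next
        case False
        then obtain e where "e \<in> missing k ?h" "e \<noteq> c" using col by blast
        then show ?thesis using go[of e] col by (auto simp: missing_def)
      qed
    qed
  next
    case True
    then have "?S \<inter> V = V" by blast
    then have i: "n = 2 * i + 1" using card' V by simp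
    \<comment> \<open>Here \<open>n div 2 = i\<close>, so \<open>k \<le> i + 2\<close>.\<close>
    then have le: "card (missing k ?h) \<le> 1" using cardM k n by auto
    show ?thesis
    proof (cases rule: UV)
      case unc
      then have SV: "?S = V" using True v by blast
      show ?thesis
      proof (cases "missing k ?h = {}")
        case True
        then show ?thesis using stuckI[OF R', of a] SV ab by simp
      next
        case False
        then obtain c where "c \<in> missing k ?h" by blast
        then have c: "missing k ?h = {c}" by (rule missing_eq_singleton[OF le])
        then have "c \<in> legal_colors G k ?h a" using unc va by (simp add: legal_colors_missing)
        then have L': "legal_move G k ?h (a, c)" using in_round_legalI[OF R', of a] SV ab verts by simp
        have "?S \<noteq> verts G" using SV ab verts by auto
        then have "in_round k ((a, c) # ?h) 0 (insert a V)"
          using in_round_move[OF R' _ L'] SV by auto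
        then have "bob_last k ((a, c) # ?h)"
          using c ab missing_U[OF ab(2), of k c ?h] by (auto simp: bob_last_def)
        then show ?thesis using L' by (auto simp: bob_inv_def)
      qed
    next
      case (col c)
      then have "?S = verts G" using True R' verts by (auto simp: in_round_def)
      then have "in_round k ?h 1 {}" using R' in_round_full[of k ?h 0] by simp
      moreover have "missing k ?h = {c}" by (rule missing_eq_singleton[OF le col(2)])
      ultimately show ?thesis using stuckI[of k ?h 1 "{}" a] col va by simp
    qed
  qed
qed

section \<open>Bob's replies up to the end of the second round\<close>

text \<open>Alice has only the other vertex of \<open>{a, b}\<close> left, which does not affect
  \<open>V\<close>. Bob then opens the second round at \<open>u\<close>, whose own color is the only
  missing one.\<close>

lemma bob_last_step:
  assumes "bob_last k h" "legal_move G k h (v, d)"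
  shows "stuck k ((v, d) # h)"
proof -
  obtain u c where u: "u \<in> {a, b}" and R: "in_round k h 0 (insert u V)"
    and c: "missing k h = {c}" "map_of h u = Some c"
    using assms by (auto simp: bob_last_def)
  have ne: "insert u V \<noteq> verts G" using u ab verts by auto
  have v: "v \<in> {a, b}" "v \<noteq> u" "v \<notin> V" and R': "in_round k ((v, d) # h) 0 (insert v (insert u V))"
    using in_round_move[OF R ne assms(2)] u ab verts by auto
  have "insert v (insert u V) = verts G" using u v verts by auto
  then have "in_round k ((v, d) # h) 1 {}" using R' in_round_full[of k "(v, d) # h" 0] by simp
  then show ?thesis
    using u v c missing_U[of v k d h] by (intro stuckI[of k "(v, d) # h" 1 "{}" u]) auto
qed

text \<open>Alice cannot choose \<open>a\<close> or \<open>b\<close>, and unless she removes a color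
  \<open>d\<close> from \<open>V\<close>, Bob chooses \<open>a\<close>. Otherwise he restores
  \<open>d\<close> at an unchosen vertex whose color occurs elsewhere in \<open>V\<close>.\<close>

lemma bob_second_step:
  assumes F: "bob_second k h S j" and L: "legal_move G k h (v, e)"
  shows "stuck k ((v, e) # h) \<or>
    (\<exists>m'. legal_move G k ((v, e) # h) m' \<and> bob_inv k (m' # (v, e) # h))"
proof -
  let ?h = "(v, e) # h" and ?S = "insert v S"
  obtain c where R: "in_round k h 1 S" and S: "S \<subseteq> V" "card S = 2 * j"
    and c: "missing k h = {c}" "map_of h a = Some c" "map_of h b = Some c"
    and j: "j = 0 \<or> j + 1 \<le> card (map_of h ` S)"
    using F by (auto simp: bob_second_def)
  have ne: "S \<noteq> verts G" using S ab verts by auto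
  have "v \<notin> {a, b}"
  proof
    assume "v \<in> {a, b}"
    then have "legal_colors G k h v = {}" using c by (auto simp: legal_colors_missing)
    then show False using L by (simp add: legal_move_def)
  qed
  then have v: "v \<in> V" "v \<notin> S" and R': "in_round k ?h 1 ?S"
    using in_round_move[OF R ne L] verts by auto
  have ne': "?S \<noteq> verts G" using S v ab verts by auto
  have U: "map_of ?h a = Some c" "map_of ?h b = Some c" using c v ab by auto
  have e: "e \<in> {1..k}" "e \<noteq> c"
    using L v c by (auto simp: legal_move_def legal_colors_V)
  have "c \<in> {1..k}" using c(1) by (auto simp: missing_def)
  have cM: "c \<in> missing k ?h"
  proof -
    have "c \<in> missing k h" using c by simp
    then show ?thesis using e by (auto simp: missing_def)
  qed
  show ?thesis
  proof (cases "missing k ?h = {c}")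
    case True
    moreover have "a \<in> {a, b} - ?S" using S v ab by auto
    ultimately have "stuck k ?h" using U(1) by (intro stuckI[OF R', of a]) simp_all
    then show ?thesis ..
  next
    case False
    then obtain d where d: "d \<in> missing k ?h" "d \<noteq> c" using cM by blast
    have old: "map_of h v = Some d"
    proof -
      have "d \<notin> missing k h" using c d by simp
      then obtain x where x: "x \<in> V" "map_of h x = Some d" using d by (force simp: missing_def)
      moreover have "map_of ?h x \<noteq> Some d" by (rule missingD[OF d(1) x(1)])
      ultimately show ?thesis by (cases "x = v") auto
    qed
    have M: "missing k ?h = {c, d}"
    proof
      show "missing k ?h \<subseteq> {c, d}"
      proof
        fix x assume x: "x \<in> missing k ?h"
        show "x \<in> {c, d}"
        proof (rule ccontr)
          assume "x \<notin> {c, d}"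
          then have "x \<notin> missing k h" "x \<in> {1..k}" using c x by (auto simp: missing_def)
          then obtain y where "y \<in> V" "map_of h y = Some x" by (force simp: missing_def)
          moreover from this old \<open>x \<notin> {c, d}\<close> have "y \<noteq> v" by auto
          ultimately have "map_of ?h y = Some x" by simp
          then have "Some x \<in> map_of ?h ` V" using \<open>y \<in> V\<close> by (metis imageI)
          then show False using x by (simp add: missing_def)
        qed
      qed
    qed (use cM d in auto)
    define f where "f = map_of ?h"
    have finS: "finite S" using S V finite_subset by blast
    \<comment> \<open>For \<open>j = 0\<close> the color of \<open>v\<close> suffices; otherwise the
      \<open>j + 1\<close> colors on \<open>S\<close> are unchanged.\<close>
    have fS: "j + 1 \<le> card (f ` ?S)"
    proof (cases "j = 0")
      case True
      have "0 < card (f ` ?S)" using finS by (subst card_gt_0_iff) simp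
      then show ?thesis using True by simp
    next
      case False
      have "map_of h ` S \<subseteq> f ` ?S" using v by (auto simp: f_def)
      then show ?thesis using j False card_mono[of "f ` ?S" "map_of h ` S"] finS by auto
    qed
    \<comment> \<open>Otherwise the \<open>n - (2 * j + 1)\<close> unchosen vertices have colors
      distinct from each other and from the \<open>j + 1\<close> or more on \<open>?S\<close>. That
      makes at least \<open>n - j > n div 2\<close> colors on \<open>V\<close>, but with
      \<open>c\<close> and \<open>d\<close> missing only \<open>k - 2 \<le> n div 2\<close>
      remain.\<close>
    have "\<exists>w \<in> V - ?S. f w \<in> f ` (V - {w})"
    proof (rule ccontr)
      assume A: "\<not> ?thesis"
      have inj: "inj_on f (V - ?S)"
      proof (rule inj_onI, rule ccontr)
        fix x y assume "x \<in> V - ?S" "y \<in> V - ?S" "f x = f y" "x \<noteq> y"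
        then have "f x \<in> f ` (V - {x})" by auto
        then show False using A \<open>x \<in> V - ?S\<close> by blast
      qed
      have disj: "f ` (V - ?S) \<inter> f ` ?S = {}"
      proof (rule ccontr)
        assume "\<not> ?thesis"
        then obtain z where "z \<in> f ` (V - ?S)" "z \<in> f ` ?S" by blast
        then obtain x y where xy: "x \<in> V - ?S" "y \<in> ?S" "f x = f y" by blast
        then have "f x \<in> f ` (V - {x})" using S v by auto
        then show False using A xy by blast
      qed
      have "card (f ` (V - ?S)) + card (f ` ?S) = card (f ` (V - ?S) \<union> f ` ?S)"
        using card_Un_disjoint disj finS V by (metis finite_Diff finite_imageI finite_insert)
      also have "f ` (V - ?S) \<union> f ` ?S = f ` V" using S v by auto
      also have "card (f ` V) \<le> card (Some ` ({1..k} - {c, d}))"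
      proof (rule card_mono)
        show "f ` V \<subseteq> Some ` ({1..k} - {c, d})"
        proof
          fix y assume "y \<in> f ` V"
          then obtain x where x: "x \<in> V" "y = f x" by blast
          then have "y \<noteq> None" using in_round_None[OF R'] verts by (auto simp: f_def simp del: map_of.simps)
          then obtain z where z: "y = Some z" by blast
          have "map_of ?h x = Some z" using x(2)[symmetric] z unfolding f_def by (rule trans)
          then have "z \<in> {1..k}" by (rule in_round_Some[OF R'])
          moreover have "z \<notin> missing k ?h" using x z by (auto simp: missing_def f_def simp del: map_of.simps)
          ultimately show "y \<in> Some ` ({1..k} - {c, d})" using z M by auto
        qed
      qed simp
      also have "\<dots> = k - 2"
      proof -
        have "card ({1..k} - {c, d}) = k - 2"
          using d \<open>c \<in> {1..k}\<close> by (subst card_Diff_subset) (auto simp: missing_def)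
        then show ?thesis by (simp add: card_image)
      qed
      finally have "card (V - ?S) + card (f ` ?S) \<le> k - 2" using inj by (simp add: card_image)
      moreover have "card (V - ?S) = n - (2 * j + 1)"
        using card_Diff_subset[of ?S V] S v finS V by simp
      moreover have "2 * j + 1 \<le> n"
        using card_mono[of V ?S] S v finS V by simp
      ultimately show False using fS k by linarith
    qed
    then obtain w where w: "w \<in> V" "w \<notin> ?S" "f w \<in> f ` (V - {w})" by blast
    have "f w \<noteq> Some d" unfolding f_def by (rule missingD[OF d(1) w(1)])
    then have "d \<in> legal_colors G k ?h w"
      using w d U by (simp add: legal_colors_V missing_def f_def del: map_of.simps)
    then have L': "legal_move G k ?h (w, d)" using in_round_legalI[OF R'] w verts by simp
    let ?h' = "(w, d) # ?h"
    have R'': "in_round k ?h' 1 (insert w ?S)" using in_round_move[OF R' ne' L'] by blast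
    have f': "map_of ?h' = f(w \<mapsto> d)" by (simp add: f_def)
    have img: "map_of ?h' ` V = insert (Some d) (f ` V)"
    proof -
      have "map_of ?h' ` V = insert (Some d) (f ` (V - {w}))" using w(1) unfolding f' by auto
      also have "f ` (V - {w}) = f ` V" using w by blast
      finally show ?thesis .
    qed
    have "missing k ?h' = missing k ?h - {d}"
      unfolding missing_def img by (auto simp: f_def simp del: map_of.simps)
    then have M': "missing k ?h' = {c}" using M d by auto
    \<comment> \<open>As \<open>d\<close> was missing, it is new among the chosen vertices, which
      raises their count to \<open>j + 2\<close>.\<close>
    have "f ` ?S \<inter> {Some d} = {}" using d S v by (auto simp: missing_def f_def simp del: map_of.simps)
    then have "card (insert (Some d) (f ` ?S)) = card (f ` ?S) + 1" using finS by simp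
    moreover have "map_of ?h' ` insert w ?S = insert (Some d) (f ` ?S)" using w unfolding f' by auto
    ultimately have "(j + 1) + 1 \<le> card (map_of ?h' ` insert w ?S)" using fS by simp
    moreover have "card (insert w ?S) = 2 * (j + 1)" using S v w finS by simp
    moreover have "map_of ?h' a = Some c" "map_of ?h' b = Some c" using U w ab by auto
    moreover have "insert w ?S \<subseteq> V" using w v S by auto
    ultimately have "bob_second k ?h' (insert w ?S) (j + 1)"
      using R'' M' unfolding bob_second_def by blast
    then show ?thesis using L' unfolding bob_inv_def by blast
  qed
qed

lemma bob_wins: "\<not> winning_strategy G k \<sigma>"
proof (rule bob_winsI[where J = "bob_inv k" and N = "2 * (n + 2)"])
  fix h m assume inv: "bob_inv k h" and L: "legal_move G k h m"
  obtain v c where m: "m = (v, c)" by fastforce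
  note L = L[unfolded m]
  have "stuck k (m # h) \<or> (\<exists>m'. legal_move G k (m # h) m' \<and> bob_inv k (m' # m # h))"
  proof -
    consider (first) S i where "S \<noteq> verts G" "bob_first k h S i" | (last) "bob_last k h"
      | (second) S j where "bob_second k h S j"
      using inv by (auto simp: bob_inv_def)
    then show ?thesis
    proof cases
      case first
      have "v \<in> V \<or> v = a \<or> v = b"
        using L verts by (auto simp: legal_move_def available_def)
      then show ?thesis
        using bob_first_step_V[OF first(2,1) L] bob_first_step_U[OF first(2,1) L, of b]
          bob_first_step_U[OF first(2,1) L, of a] m by blast
    qed (use bob_last_step bob_second_step L m in blast)+
  qed
  then show "(\<exists>v \<in> available G (m # h). legal_colors G k (m # h) v = {})
      \<or> (\<exists>m'. legal_move G k (m # h) m' \<and> bob_inv k (m' # m # h))"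
    by (simp add: stuck_def)
qed (use bob_inv_Nil bob_inv_length in auto)

end

section \<open>Alice's strategy for three vertices and four colors\<close>

lemma legal_colors_V_nonempty:
  assumes "v \<in> V"
  shows "legal_colors G 4 h v \<noteq> {}"
proof -
  let ?B = "{map_of h v, map_of h a, map_of h b}"
  have "card ?B < 4" by (simp add: card_insert_if)
  then show ?thesis using ex_color_notin[of ?B 4] assms by (fastforce simp: legal_colors_V)
qed

text \<open>A color in use on \<open>V\<close> is on neither \<open>a\<close> nor \<open>b\<close>,
  so it can be copied within \<open>V\<close>; this is how Alice creates repetitions.\<close>

lemma legal_color_recolor:
  assumes "in_round k h t S" "w \<in> V" "x \<in> V" "map_of h x = Some c" "map_of h w \<noteq> Some c"
  shows "c \<in> legal_colors G k h w"
  using assms in_round_Some[OF assms(1,4)] by (auto simp: legal_colors_V in_round_def)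

text \<open>
  Here \<open>\<not> inj_on (map_of h) V\<close> says that \<open>V\<close> does not carry three colors, where being uncolored counts
  as a color. Alice begins the rounds with an even number of completed rounds.
\<close>

definition alice_even :: "'a history \<Rightarrow> 'a set \<Rightarrow> bool" where
  "alice_even h S \<longleftrightarrow> S = {}
    \<or> card S = 2 \<and> (\<not> inj_on (map_of h) (S \<inter> V)
        \<or> (\<exists>x \<in> S \<inter> V. \<exists>w \<in> V - S. map_of h w \<noteq> map_of h x))
    \<or> card S = 4 \<and> \<not> inj_on (map_of h) (S \<inter> V)"

text \<open>Each case lets Alice keep \<open>a\<close> and \<open>b\<close> colorable: they are done
  for this round, or \<open>V\<close> has a repetition, or an unchosen vertex of \<open>V\<close> is
  left with which to create one.\<close>

definition alice_odd :: "'a history \<Rightarrow> 'a set \<Rightarrow> bool" where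
  "alice_odd h S \<longleftrightarrow> card S = 1 \<and> (S \<subseteq> V \<or> \<not> inj_on (map_of h) V)
    \<or> card S = 3 \<and> ({a, b} \<subseteq> S \<or> \<not> inj_on (map_of h) V \<or> \<not> V \<subseteq> S)"

definition alice_inv :: "'a history \<Rightarrow> bool" where
  "alice_inv h \<longleftrightarrow> (\<exists>t S. in_round 4 h t S \<and> S \<noteq> verts G
    \<and> (if even t then alice_even h S else alice_odd h S))"

lemma alice_inv_evenI:
  "in_round 4 h t S \<Longrightarrow> S \<noteq> verts G \<Longrightarrow> even t \<Longrightarrow> alice_even h S \<Longrightarrow> alice_inv h"
  unfolding alice_inv_def by auto

lemma alice_inv_oddI:
  "in_round 4 h t S \<Longrightarrow> S \<noteq> verts G \<Longrightarrow> odd t \<Longrightarrow> alice_odd h S \<Longrightarrow> alice_inv h"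
  unfolding alice_inv_def by auto

definition alice_can_move :: "'a history \<Rightarrow> bool" where
  "alice_can_move h \<longleftrightarrow> (\<exists>m. legal_move G 4 h m
      \<and> (\<forall>v \<in> available G (m # h). legal_colors G 4 (m # h) v \<noteq> {})
      \<and> (\<forall>m'. legal_move G 4 (m # h) m' \<longrightarrow> alice_inv (m' # m # h)))"

section \<open>Repetitions of colors in \<open>V\<close> and safe moves\<close>

lemma inj_on_move_U: "v \<notin> V \<Longrightarrow> inj_on (map_of ((v, c) # h)) V \<longleftrightarrow> inj_on (map_of h) V"
  by (auto simp: inj_on_def)

text \<open>Chosen vertices keep their colors until the round ends, so a repetition among them
  lasts.\<close>

lemma not_inj_on_move:
  assumes "\<not> inj_on (map_of h) (S \<inter> V)" "v \<notin> S"
  shows "\<not> inj_on (map_of ((v, c) # h)) (insert v S \<inter> V)"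
proof -
  obtain x y where xy: "x \<in> S \<inter> V" "y \<in> S \<inter> V" "x \<noteq> y" "map_of h x = map_of h y"
    using assms(1) by (auto simp: inj_on_def)
  then have "map_of ((v, c) # h) x = map_of ((v, c) # h) y" using assms(2) by auto
  then show ?thesis using xy by (meson Int_iff inj_onD insertI2)
qed

lemma not_inj_on_recolor:
  assumes "w \<in> A" "x \<in> A" "w \<noteq> x" "map_of h x = Some c"
  shows "\<not> inj_on (map_of ((w, c) # h)) A"
  using assms inj_onD[of "map_of ((w, c) # h)" A w x] by auto

lemma not_inj_on_subset: "\<not> inj_on f (S \<inter> V) \<Longrightarrow> \<not> inj_on f V"
  using inj_on_subset by blast

context
  assumes n3: "n = 3"
begin

lemma ex_V_notin: "finite A \<Longrightarrow> card A < 3 \<Longrightarrow> \<exists>z \<in> V. z \<notin> A"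
  using card_mono[of A V] V n3 by fastforce

text \<open>With a repetition, \<open>V\<close> shows at most two values; the own color of
  \<open>a\<close> or \<open>b\<close> makes three, fewer than four.\<close>

lemma legal_colors_nonempty:
  assumes "v \<in> V \<or> \<not> inj_on (map_of h) V" "v \<in> verts G"
  shows "legal_colors G 4 h v \<noteq> {}"
proof (cases "v \<in> V")
  case True
  then show ?thesis by (rule legal_colors_V_nonempty)
next
  case False
  then have v: "v \<in> {a, b}" using assms(2) verts by blast
  have "card (map_of h ` V) \<noteq> card V"
    using assms(1) False V eq_card_imp_inj_on by blast
  then have "card (map_of h ` V) < 3"
    using card_image_le[OF V(1), of "map_of h"] V n3 by simp
  then have "card (insert (map_of h v) (map_of h ` V)) < 4"
    using V by (simp add: card_insert_if)
  then show ?thesis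
    using ex_color_notin[of "insert (map_of h v) (map_of h ` V)" 4] V legal_colors_U[OF v, of 4 h]
    by fastforce
qed

text \<open>By \<open>safe\<close>, either \<open>V\<close> has a repetition and nothing is stuck,
  or only vertices of \<open>V\<close> are still available in an unfinished round.\<close>

lemma alice_can_moveI:
  assumes R: "in_round 4 h t S" "S \<noteq> verts G" and v: "v \<in> verts G - S"
    and c: "c \<in> legal_colors G 4 h v"
    and safe: "\<not> inj_on (map_of ((v, c) # h)) V \<or> {a, b} \<subseteq> insert v S \<and> insert v S \<noteq> verts G"
    and inv: "\<And>y d. in_round 4 ((v, c) # h) t (insert v S) \<Longrightarrow>
      legal_move G 4 ((v, c) # h) (y, d) \<Longrightarrow> alice_inv ((y, d) # (v, c) # h)"
  shows "alice_can_move h"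
proof -
  let ?h = "(v, c) # h"
  have L: "legal_move G 4 h (v, c)" using in_round_legalI[OF R(1) v c] .
  have R': "in_round 4 ?h t (insert v S)" using in_round_move[OF R L] by blast
  have "legal_colors G 4 ?h w \<noteq> {}" if w: "w \<in> available G ?h" for w
  proof (rule legal_colors_nonempty)
    show wG: "w \<in> verts G" using w by (simp add: available_def)
    show "w \<in> V \<or> \<not> inj_on (map_of ?h) V"
    proof (rule disjCI, simp only: not_not)
      assume "inj_on (map_of ?h) V"
      then have *: "{a, b} \<subseteq> insert v S" "insert v S \<noteq> verts G" using safe by blast+
      then have "w \<notin> insert v S" using in_round_available[OF R'] w by blast
      then show "w \<in> V" using * wG verts by blast
    qed
  qed
  then show ?thesis using L inv[OF R'] unfolding alice_can_move_def by (metis surj_pair)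
qed

lemma card_eq_verts: "S \<subseteq> verts G \<Longrightarrow> card S = 5 \<Longrightarrow> S = verts G"
  using card_subset_eq[OF finite_verts] card_verts n3 by simp

lemma in_round_card: "in_round k h t S \<Longrightarrow> v \<notin> S \<Longrightarrow> card (insert v S) = Suc (card S)"
  using finite_subset[OF _ finite_verts] by (simp add: in_round_def)

section \<open>Rounds begun by Alice\<close>

lemma alice_even_0:
  assumes R: "in_round 4 h t {}" and t: "even t"
  shows "alice_can_move h"
proof -
  obtain x y z where xyz: "V = {x, y, z}" "x \<noteq> y" "x \<noteq> z" "y \<noteq> z"
    using V n3 by (auto simp: card_3_iff)
  let ?f = "map_of h"
  have VG: "V \<subseteq> verts G" "verts G \<noteq> {}" using verts by auto
  \<comment> \<open>Besides the repetition, a vertex \<open>w\<close> of another color is kept: if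
    Bob replies at \<open>a\<close> or \<open>b\<close>, Alice can later copy \<open>c\<close> to
    \<open>w\<close>.\<close>
  have "\<exists>v \<in> V. \<exists>c \<in> legal_colors G 4 h v. \<not> inj_on (map_of ((v, c) # h)) V
      \<and> (\<exists>w \<in> V - {v}. ?f w \<noteq> Some c)"
  proof (cases "?f y = ?f x \<and> ?f z = ?f x")
    case True
    obtain c where c: "c \<in> legal_colors G 4 h x"
      using legal_colors_V_nonempty[of x] xyz by blast
    then have "?f x \<noteq> Some c" by (simp add: legal_colors_def)
    moreover have "\<not> inj_on (map_of ((x, c) # h)) V"
      using True xyz by (auto simp: inj_on_def)
    moreover have "x \<in> V" "y \<in> V - {x}" using xyz by auto
    ultimately show ?thesis
      using c True by (intro bexI[of _ x] bexI[of _ c] conjI bexI[of _ y]) simp_all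
  next
    case False
    \<comment> \<open>Of three vertices not all alike, some \<open>q\<close> differs from both
      others; \<open>p\<close> copies it and \<open>r\<close> stays different.\<close>
    then obtain p q r where pqr: "p \<in> V" "q \<in> V" "r \<in> V" "p \<noteq> q" "r \<noteq> p" "?f p \<noteq> ?f q" "?f r \<noteq> ?f q"
      using xyz by (metis insertCI)
    have G: "p \<in> verts G" "q \<in> verts G" using pqr VG by auto
    have "t \<noteq> 0" using pqr in_round_None[OF R G(1)] in_round_None[OF R G(2)] by auto
    then obtain c where c: "?f q = Some c" using in_round_None[OF R G(2)] by auto
    have "c \<in> legal_colors G 4 h p" using legal_color_recolor[OF R pqr(1,2) c] pqr c by simp
    moreover have "\<not> inj_on (map_of ((p, c) # h)) V"
      using not_inj_on_recolor[OF pqr(1,2,4) c] .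
    moreover have "r \<in> V - {p}" "?f r \<noteq> Some c" using pqr c by auto
    ultimately show ?thesis using pqr(1) by (intro bexI[of _ p] bexI[of _ c] conjI bexI[of _ r])
  qed
  then obtain v c w where v: "v \<in> V" "c \<in> legal_colors G 4 h v"
    and inj: "\<not> inj_on (map_of ((v, c) # h)) V"
    and w: "w \<in> V" "w \<noteq> v" "?f w \<noteq> Some c" by blast
  show ?thesis
  proof (rule alice_can_moveI[OF R, of v c])
    let ?h = "(v, c) # h"
    fix y d assume R': "in_round 4 ?h t (insert v {})" and L: "legal_move G 4 ?h (y, d)"
    have "insert v {} \<noteq> verts G" using v w VG by blast
    note R'' = in_round_move[OF R' this L]
    let ?S = "{y, v}" and ?h' = "(y, d) # ?h"
    have y: "y \<noteq> v" using R'' by simp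
    then have card: "card ?S = 2" by simp
    then have "?S \<noteq> verts G" using card_verts n3 by auto
    moreover have "\<not> inj_on (map_of ?h') (?S \<inter> V)
        \<or> (\<exists>x \<in> ?S \<inter> V. \<exists>w \<in> V - ?S. map_of ?h' w \<noteq> map_of ?h' x)"
    proof (cases "y \<in> V")
      case True
      \<comment> \<open>If Bob's color is not \<open>c\<close>, the third vertex \<open>z\<close>
        differs from one of the two chosen ones and can later copy it.\<close>
      obtain z where z: "z \<in> V - ?S" using ex_V_notin[of ?S] card by auto
      show ?thesis
      proof (cases "c = d")
        case True
        then show ?thesis using y \<open>y \<in> V\<close> v(1) by (auto simp: inj_on_def)
      next
        case False
        then have "map_of ?h' z \<noteq> map_of ?h' v \<or> map_of ?h' z \<noteq> map_of ?h' y"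
          using y by auto
        then show ?thesis using z \<open>y \<in> V\<close> v(1) by blast
      qed
    next
      case False
      then have "w \<in> V - ?S" "v \<in> ?S \<inter> V" using w v by auto
      moreover have "map_of ?h' w \<noteq> map_of ?h' v" using w y False by auto
      ultimately show ?thesis by blast
    qed
    ultimately show "alice_inv ?h'"
      using t card by (intro alice_inv_evenI[OF R''(2)]) (simp_all only: alice_even_def simp_thms)
  qed (use v VG inj in auto)
qed

text \<open>If the chosen vertices of \<open>V\<close> have no repetition yet, \<open>w\<close>
  copies \<open>x\<close>; otherwise any legal move at an unchosen vertex keeps it.\<close>

lemma alice_even_2:
  assumes R: "in_round 4 h t S" and t: "even t" and card: "card S = 2"
    and S: "\<not> inj_on (map_of h) (S \<inter> V) \<or> (\<exists>x \<in> S \<inter> V. \<exists>w \<in> V - S. map_of h w \<noteq> map_of h x)"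
  shows "alice_can_move h"
proof -
  have ne: "S \<noteq> verts G" using card card_verts n3 by auto
  have SG: "S \<subseteq> verts G" using R by (simp add: in_round_def)
  have "\<exists>v \<in> verts G - S. \<exists>c \<in> legal_colors G 4 h v.
      \<not> inj_on (map_of ((v, c) # h)) (insert v S \<inter> V)"
  proof (cases "inj_on (map_of h) (S \<inter> V)")
    case False
    obtain v where v: "v \<in> verts G - S" using ne SG by blast
    moreover obtain c where "c \<in> legal_colors G 4 h v"
      using legal_colors_nonempty[of v h] not_inj_on_subset[OF False] v by blast
    ultimately show ?thesis
      using not_inj_on_move[OF False, of v c] by (intro bexI[of _ v] bexI[of _ c]) simp_all
  next
    case True
    then obtain x w where xw: "x \<in> S \<inter> V" "w \<in> V - S" "map_of h w \<noteq> map_of h x" using S by blast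
    obtain c where c: "map_of h x = Some c" using in_round_None[OF R, of x] xw SG by blast
    have "c \<in> legal_colors G 4 h w" using legal_color_recolor[OF R _ _ c] xw c by simp
    moreover have "\<not> inj_on (map_of ((w, c) # h)) (insert w S \<inter> V)"
      using xw by (intro not_inj_on_recolor[OF _ _ _ c]) auto
    moreover have "w \<in> verts G - S" using xw verts by blast
    ultimately show ?thesis by (intro bexI[of _ w] bexI[of _ c])
  qed
  then obtain v c where v: "v \<in> verts G - S" and c: "c \<in> legal_colors G 4 h v"
    and inj: "\<not> inj_on (map_of ((v, c) # h)) (insert v S \<inter> V)" by blast
  show ?thesis
  proof (rule alice_can_moveI[OF R ne v c])
    let ?h = "(v, c) # h"
    fix y d assume R': "in_round 4 ?h t (insert v S)" and L: "legal_move G 4 ?h (y, d)"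
    have card': "card (insert v S) = 3" using in_round_card[OF R] v card by simp
    then have "insert v S \<noteq> verts G" using card_verts n3 by auto
    note R'' = in_round_move[OF R' this L]
    then have y: "y \<notin> insert v S" by simp
    have "card (insert y (insert v S)) = 4" using in_round_card[OF R' y] card' by simp
    moreover from this have "insert y (insert v S) \<noteq> verts G" using card_verts n3 by auto
    ultimately show "alice_inv ((y, d) # ?h)"
      using t not_inj_on_move[OF inj y] by (intro alice_inv_evenI[OF R''(2)]) (simp_all add: alice_even_def)
  qed (use not_inj_on_subset[OF inj] in blast)
qed

text \<open>Alice completes the round, as there are five vertices. Bob's next move is in
  \<open>V\<close>, which \<open>alice_odd\<close> admits, or at \<open>a\<close> or
  \<open>b\<close>, which leaves the repetition intact.\<close>

lemma alice_even_4:
  assumes R: "in_round 4 h t S" and t: "even t" and card: "card S = 4"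
    and inj: "\<not> inj_on (map_of h) (S \<inter> V)"
  shows "alice_can_move h"
proof -
  have ne: "S \<noteq> verts G" using card card_verts n3 by auto
  have SG: "S \<subseteq> verts G" using R by (simp add: in_round_def)
  obtain v where v: "v \<in> verts G - S" using ne SG by blast
  obtain c where c: "c \<in> legal_colors G 4 h v"
    using legal_colors_nonempty[of v h] not_inj_on_subset[OF inj] v by blast
  have inj': "\<not> inj_on (map_of ((v, c) # h)) V"
    using v by (intro not_inj_on_subset[OF not_inj_on_move[OF inj]]) simp
  show ?thesis
  proof (rule alice_can_moveI[OF R ne v c])
    let ?h = "(v, c) # h"
    fix y d assume R': "in_round 4 ?h t (insert v S)" and L: "legal_move G 4 ?h (y, d)"
    have "insert v S = verts G" using card_eq_verts in_round_card[OF R] v card SG by simp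
    then have R1: "in_round 4 ?h (Suc t) {}" using R' in_round_full by simp
    have "{} \<noteq> verts G" using v by blast
    note R'' = in_round_move[OF R1 this L]
    have "{y} \<subseteq> V \<or> \<not> inj_on (map_of ((y, d) # ?h)) V"
      using inj' inj_on_move_U[of y d ?h] by blast
    moreover have "card {y} = 1" by simp
    moreover have "{y} \<noteq> verts G" using card_verts n3 \<open>card {y} = 1\<close>
      by (cases "{y} = verts G") simp_all
    ultimately show "alice_inv ((y, d) # ?h)"
      using t by (intro alice_inv_oddI[OF R''(2)]) (simp_all add: alice_odd_def)
  qed (use inj' in blast)
qed

section \<open>Rounds begun by Bob\<close>

text \<open>If \<open>V\<close> has a repetition, Alice chooses \<open>a\<close> or
  \<open>b\<close>. Otherwise Bob's vertex lies in \<open>V\<close>, and copying its color creates a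
  repetition among chosen vertices.\<close>

lemma alice_odd_1:
  assumes R: "in_round 4 h t S" and t: "odd t" and card: "card S = 1"
    and S: "S \<subseteq> V \<or> \<not> inj_on (map_of h) V"
  shows "alice_can_move h"
proof -
  have ne: "S \<noteq> verts G" using card card_verts n3 by auto
  obtain y where y: "S = {y}" using card card_1_singletonE by blast
  have "\<exists>v \<in> verts G - S. \<exists>c \<in> legal_colors G 4 h v. \<not> inj_on (map_of ((v, c) # h)) V
    \<and> (v \<notin> V \<or> \<not> inj_on (map_of ((v, c) # h)) (insert v S \<inter> V))"
  proof (cases "inj_on (map_of h) V")
    case False
    obtain u where u: "u \<in> {a, b}" "u \<in> verts G - S" using y verts ab by auto
    moreover from this obtain c where "c \<in> legal_colors G 4 h u"
      using legal_colors_nonempty[of u h] False by blast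
    moreover have "u \<notin> V" using u ab by blast
    ultimately show ?thesis
      using inj_on_move_U[of u c h] False by (intro bexI[of _ u] bexI[of _ c]) simp_all
  next
    case True
    then have yV: "y \<in> V" using S y by blast
    obtain w where w: "w \<in> V" "w \<noteq> y" using ex_V_notin[of "{y}"] by auto
    then have "map_of h w \<noteq> map_of h y" using True yV by (meson inj_onD)
    moreover obtain c where c: "map_of h y = Some c"
      using in_round_None[OF R, of y] t yV verts by fastforce
    ultimately have "c \<in> legal_colors G 4 h w" using legal_color_recolor[OF R w(1) yV c] by simp
    moreover have "\<not> inj_on (map_of ((w, c) # h)) (insert w S \<inter> V)"
      using w yV y by (intro not_inj_on_recolor[OF _ _ w(2) c]) auto
    moreover have "w \<in> verts G - S" using w y verts by blast
    ultimately show ?thesis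
      using not_inj_on_subset by (intro bexI[of _ w] bexI[of _ c] conjI disjI2)
  qed
  then obtain v c where v: "v \<in> verts G - S" and c: "c \<in> legal_colors G 4 h v"
    and inj: "\<not> inj_on (map_of ((v, c) # h)) V"
    and V': "v \<notin> V \<or> \<not> inj_on (map_of ((v, c) # h)) (insert v S \<inter> V)" by blast
  show ?thesis
  proof (rule alice_can_moveI[OF R ne v c])
    let ?h = "(v, c) # h"
    fix y d assume R': "in_round 4 ?h t (insert v S)" and L: "legal_move G 4 ?h (y, d)"
    have card': "card (insert v S) = 2" using in_round_card[OF R] v card by simp
    then have "insert v S \<noteq> verts G" using card_verts n3 by auto
    note R'' = in_round_move[OF R' this L]
    let ?S = "insert y (insert v S)"
    have y: "y \<notin> insert v S" using R'' by simp
    have c3: "card ?S = 3" using in_round_card[OF R' y] card' by simp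
    \<comment> \<open>If Alice moved in \<open>V\<close>, her repetition is fixed; if at
      \<open>a\<close> or \<open>b\<close>, at most two of the three chosen vertices lie in
      \<open>V\<close>.\<close>
    have "\<not> inj_on (map_of ((y, d) # ?h)) V \<or> \<not> V \<subseteq> ?S"
    proof (cases "v \<in> V")
      case True
      then have "\<not> inj_on (map_of ((y, d) # ?h)) (insert y (insert v S) \<inter> V)"
        using V' by (intro not_inj_on_move[OF _ y]) blast
      then show ?thesis by (intro disjI1 not_inj_on_subset)
    next
      case False
      have fin: "finite ?S" using c3 by (intro card_ge_0_finite) linarith
      have "card V = card ?S" using c3 V n3 by linarith
      then have "\<not> V \<subseteq> ?S" using card_subset_eq[OF fin, of V] False by blast
      then show ?thesis ..
    qed
    moreover have "?S \<noteq> verts G"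
    proof
      assume "?S = verts G"
      then have "card ?S = n + 2" using card_verts by (rule ssubst)
      then show False using c3 n3 by linarith
    qed
    ultimately show "alice_inv ((y, d) # ?h)"
      using t c3 by (intro alice_inv_oddI[OF R''(2)]) (simp_all only: alice_odd_def simp_thms)
  qed (use inj in blast)
qed

text \<open>Once \<open>a\<close> and \<open>b\<close> are chosen, the rest of the round is safe.
  Otherwise Alice ensures a repetition for Bob's last move; then she begins a round, where
  \<open>alice_even\<close> asks nothing of the coloring.\<close>

lemma alice_odd_3:
  assumes R: "in_round 4 h t S" and t: "odd t" and card: "card S = 3"
    and S: "{a, b} \<subseteq> S \<or> \<not> inj_on (map_of h) V \<or> \<not> V \<subseteq> S"
  shows "alice_can_move h"
proof -
  have ne: "S \<noteq> verts G" using card card_verts n3 by auto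
  have SG: "S \<subseteq> verts G" using R by (simp add: in_round_def)
  have "\<exists>v \<in> verts G - S. \<exists>c \<in> legal_colors G 4 h v.
      \<not> inj_on (map_of ((v, c) # h)) V \<or> {a, b} \<subseteq> S"
  proof (cases "{a, b} \<subseteq> S")
    case True
    then obtain v where "v \<in> V" "v \<in> verts G - S" using ne SG verts by blast
    then show ?thesis using True legal_colors_V_nonempty[of v h] by blast
  next
    case False
    then obtain u where u: "u \<in> {a, b}" "u \<in> verts G - S" using verts by blast
    show ?thesis
    proof (cases "inj_on (map_of h) V")
      case inj: False
      then obtain c where "c \<in> legal_colors G 4 h u"
        using legal_colors_nonempty[of u h] u by blast
      moreover have "u \<notin> V" using u ab by blast
      ultimately show ?thesis
        using inj_on_move_U[of u c h] inj u(2) by (intro bexI[of _ u] bexI[of _ c]) simp_all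
    next
      case True
      then obtain w where w: "w \<in> V" "w \<notin> S" using S False by blast
      obtain x where x: "x \<in> V" "w \<noteq> x" using ex_V_notin[of "{w}"] by auto
      then have "map_of h w \<noteq> map_of h x" using True w by (meson inj_onD)
      moreover obtain c where c: "map_of h x = Some c"
        using in_round_None[OF R, of x] t x verts by fastforce
      ultimately have "c \<in> legal_colors G 4 h w" using legal_color_recolor[OF R w(1) x(1) c] by simp
      moreover have "\<not> inj_on (map_of ((w, c) # h)) V"
        using not_inj_on_recolor[OF w(1) x c] .
      moreover have "w \<in> verts G - S" using w verts by blast
      ultimately show ?thesis by (intro bexI[of _ w] bexI[of _ c] disjI1)
    qed
  qed
  then obtain v c where v: "v \<in> verts G - S" and c: "c \<in> legal_colors G 4 h v"
    and inj: "\<not> inj_on (map_of ((v, c) # h)) V \<or> {a, b} \<subseteq> S" by blast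
  have card': "card (insert v S) = 4" using in_round_card[OF R] v card by simp
  then have ne': "insert v S \<noteq> verts G" using card_verts n3 by auto
  show ?thesis
  proof (rule alice_can_moveI[OF R ne v c])
    let ?h = "(v, c) # h"
    fix y d assume R': "in_round 4 ?h t (insert v S)" and L: "legal_move G 4 ?h (y, d)"
    note R'' = in_round_move[OF R' ne' L]
    have "insert y (insert v S) = verts G"
      using R'' card' in_round_card[OF R', of y] by (intro card_eq_verts) (auto simp: in_round_def)
    then have "in_round 4 ((y, d) # ?h) (Suc t) {}" using R'' in_round_full by simp
    moreover have "{} \<noteq> verts G" "even (Suc t)" using v t by auto
    ultimately show "alice_inv ((y, d) # ?h)"
      by (rule alice_inv_evenI) (simp add: alice_even_def)
  qed (use inj ne' in blast)
qed

lemma alice_wins_K23: "\<exists>\<sigma>. winning_strategy G 4 \<sigma>"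
proof (rule alice_winsI[where I = alice_inv])
  have "{} \<noteq> verts G" using verts by blast
  moreover have "even (0 :: nat)" by simp
  ultimately show "alice_inv []"
    by (intro alice_inv_evenI[OF in_round_Nil]) (simp_all add: alice_even_def)
next
  fix h assume "alice_inv h"
  then obtain t S where R: "in_round 4 h t S" and S: "if even t then alice_even h S else alice_odd h S"
    unfolding alice_inv_def by blast
  have "alice_can_move h"
  proof (cases "even t")
    case True
    then have "alice_even h S" using S by simp
    then show ?thesis
      unfolding alice_even_def using alice_even_0 alice_even_2 alice_even_4 R True by metis
  next
    case False
    then have "alice_odd h S" using S by simp
    then show ?thesis unfolding alice_odd_def using alice_odd_1 alice_odd_3 R False by metis
  qed
  then show "\<exists>m. legal_move G 4 h m
      \<and> (\<forall>v \<in> available G (m # h). legal_colors G 4 (m # h) v \<noteq> {})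
      \<and> (\<forall>m'. legal_move G 4 (m # h) m' \<longrightarrow> alice_inv (m' # m # h))"
    unfolding alice_can_move_def .
qed

end

section \<open>The eternal game chromatic number\<close>

text \<open>The degrees are \<open>n\<close> and 2. Besides the upper bound for
  \<open>n = 2\<close>, this shows that the minimum defining the game number is attained.\<close>

lemma alice_wins_add_2:
  assumes "2 \<le> n"
  shows "\<exists>\<sigma>. winning_strategy G (n + 2) \<sigma>"
proof (rule alice_wins_if_degree_small)
  fix v assume "v \<in> verts G"
  then have "{u. v \<rightarrow>\<^bsub>G\<^esub> u} = V \<or> {u. v \<rightarrow>\<^bsub>G\<^esub> u} = {a, b}"
    using verts ab by (auto simp: arcs)
  then show "finite {u. v \<rightarrow>\<^bsub>G\<^esub> u} \<and> card {u. v \<rightarrow>\<^bsub>G\<^esub> u} + 2 \<le> n + 2"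
    using V ab assms by auto
qed (use verts finite_verts in auto)

lemma game_number_ge:
  assumes "2 \<le> n"
  shows "n div 2 + 3 \<le> \<chi>\<^sub>g\<^sup>\<infinity> G"
proof (rule ccontr)
  assume A: "\<not> ?thesis"
  \<comment> \<open>The least number is itself winning for Alice, while \<open>bob_wins\<close>
    excludes every value up to \<open>n div 2 + 2\<close>.\<close>
  have "\<exists>\<sigma>. winning_strategy G (\<chi>\<^sub>g\<^sup>\<infinity> G) \<sigma>"
    unfolding eternal_game_chromatic_number_def
    using alice_wins_add_2[OF assms] by (rule LeastI)
  then show False using bob_wins[OF assms, of "\<chi>\<^sub>g\<^sup>\<infinity> G"] A by auto
qed

lemma game_number_eq_4:
  assumes "n \<in> {2, 3}"
  shows "\<chi>\<^sub>g\<^sup>\<infinity> G = 4"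
proof (rule antisym)
  have "\<exists>\<sigma>. winning_strategy G 4 \<sigma>"
    using assms alice_wins_add_2 alice_wins_K23 by auto
  then show "\<chi>\<^sub>g\<^sup>\<infinity> G \<le> 4"
    unfolding eternal_game_chromatic_number_def by (rule Least_le)
  show "4 \<le> \<chi>\<^sub>g\<^sup>\<infinity> G" using game_number_ge assms by auto
qed

end

theorem proposition3p11:
  fixes G :: "('a, 'b) pre_digraph" and n :: nat
  assumes "K\<^bsub>2,n\<^esub> G"
  shows "(n \<in> {2, 3} \<longrightarrow> \<chi>\<^sub>g\<^sup>\<infinity> G = 4)
    \<and> (n > 3 \<and> even n \<longrightarrow> real (\<chi>\<^sub>g\<^sup>\<infinity> G) \<ge> real n / 2 + 3)
    \<and> (n > 3 \<and> odd n \<longrightarrow> int (\<chi>\<^sub>g\<^sup>\<infinity> G) \<ge> \<lfloor>real n / 2\<rfloor> + 3)"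
proof -
  obtain U V where UV: "verts G = U \<union> V" "U \<inter> V = {}" "card U = 2" "card V = n"
      "arcs_ends G = U \<times> V \<union> V \<times> U" and "graph G"
    using assms unfolding complete_bipartite_digraph_def by blast
  interpret graph G by fact
  obtain a b where U: "U = {a, b}" "a \<noteq> b" using UV(3) by (auto simp: card_2_iff)
  have "finite V" using finite_verts UV(1) by simp
  then interpret K2n G a b V n using UV U by unfold_locales auto
  have ge: "n div 2 + 3 \<le> \<chi>\<^sub>g\<^sup>\<infinity> G" if "n > 3" using game_number_ge that by simp
  have "\<lfloor>real n / 2\<rfloor> = int (n div 2)"
    using floor_divide_of_nat_eq[of n 2, where ?'a = real] by simp
  moreover have "real n / 2 = real (n div 2)" if "even n" using that by (simp add: real_of_nat_div)
  ultimately show ?thesis using game_number_eq_4 ge by force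
qed

end
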